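(* Let $\mathcal{H}$ be a separable Hilbert space. If $(X,\mu)$ is a measure space, with $\mu$ non-trivial, $\sigma$-finite and positive, such that there exists an orthonormal basis $\{\psi_n\}_{n\in\mathbb{N}}$ of $L^2(X,\mu)$ satisfying $$\sup_{n\in\mathbb{N}}\sup_{x\in X}|\psi_n(x)|=C<\infty,$$ then there exists an upper semi-frame $\Psi$ for $\mathcal{H}$ such that $\overline{\operatorname{Ran}C_\Psi}=L^2(X,\mu)$. In particular, $R(\Psi)=0$.
   Context: A map $\Psi:X\to\mathcal{H}$, $x\mapsto\Psi_x$, is an upper semi-frame for $\mathcal{H}$ if $x\mapsto\langle f,\Psi_x\rangle$ is measurable for every $f\in\mathcal{H}$ and there is $M>0$ with $0<\int_X|\langle f,\Psi_x\rangle|^2d\mu(x)\le M\|f\|^2$ for all $f\in\mathcal{H}\setminus\{0\}$. The analysis operator is $C_\Psi:\mathcal{H}\to L^2(X,\mu)$, $C_\Psi f(x)=\langle f,\Psi_x\rangle$, and the redundancy is $R(\Psi):=\dim\big((\operatorname{Ran}C_\Psi)^\perp\big)$, with orthogonal complement in $L^2(X,\mu)$.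
   Formalization: The separable Hilbert space H is additionally assumed infinite-dimensional; for finite-dimensional H the claim fails, since Ran C_Ψ is then finite-dimensional and closed while L²(X,μ) is infinite-dimensional. *)

theory Defs
  imports "HOL-Analysis.Analysis"
begin

text \<open>Inner products are linear in the first and conjugate-linear in the second argument.\<close>

class complex_vector = real_vector +
  fixes scaleC :: "complex \<Rightarrow> 'a \<Rightarrow> 'a" (infixr \<open>*\<^sub>C\<close> 75)
  assumes scaleC_add_right: "a *\<^sub>C (x + y) = a *\<^sub>C x + a *\<^sub>C y"
    and scaleC_add_left: "(a + b) *\<^sub>C x = a *\<^sub>C x + b *\<^sub>C x"
    and scaleC_scaleC: "a *\<^sub>C b *\<^sub>C x = (a * b) *\<^sub>C x"
    and scaleC_one: "1 *\<^sub>C x = x"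
    and scaleR_scaleC: "r *\<^sub>R x = complex_of_real r *\<^sub>C x"

class complex_inner = complex_vector + real_normed_vector +
  fixes cinner :: "'a \<Rightarrow> 'a \<Rightarrow> complex"
  assumes cinner_add_left: "cinner (x + y) z = cinner x z + cinner y z"
    and cinner_scaleC_left: "cinner (a *\<^sub>C x) y = a * cinner x y"
    and cinner_commute: "cinner x y = cnj (cinner y x)"
    and cinner_ge_zero: "0 \<le> Re (cinner x x)"
    and cinner_eq_zero_iff: "cinner x x = 0 \<longleftrightarrow> x = 0"
    and norm_eq_sqrt_cinner: "norm x = sqrt (Re (cinner x x))"

class complex_hilbert_space = complex_inner + banach

global_interpretation complex_vector:
  vector_space "scaleC :: complex \<Rightarrow> 'a \<Rightarrow> 'a::complex_vector"
  by unfold_locales (fact scaleC_add_right scaleC_add_left scaleC_scaleC scaleC_one)+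

definition separable_hilbert :: "'h::complex_hilbert_space itself \<Rightarrow> bool" where
  "separable_hilbert _ \<longleftrightarrow> (\<exists>D :: 'h set. countable D \<and> closure D = UNIV)"

definition infinite_dimensional :: "'h::complex_hilbert_space itself \<Rightarrow> bool" where
  "infinite_dimensional _ \<longleftrightarrow> \<not> (\<exists>B :: 'h set. finite B \<and> complex_vector.span B = UNIV)"

text \<open>
  Elements of the Hilbert space of square-integrable functions are represented by functions, and
  functions that agree almost everywhere represent the same element. Closures, orthogonal
  complements and dimensions below are therefore those of the quotient: closures are saturated
  under almost-everywhere equality, and linear independence is modulo null functions. The values
  of a function outside \<^term>\<open>space M\<close> play no role.
\<close>

definition L2_space :: "'x measure \<Rightarrow> ('x \<Rightarrow> complex) set" where
  "L2_space M = {f \<in> borel_measurable M. integrable M (\<lambda>x. (cmod (f x))\<^sup>2)}"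

definition L2_inner :: "'x measure \<Rightarrow> ('x \<Rightarrow> complex) \<Rightarrow> ('x \<Rightarrow> complex) \<Rightarrow> complex" where
  "L2_inner M f g = (\<integral>x. f x * cnj (g x) \<partial>M)"

definition L2_norm :: "'x measure \<Rightarrow> ('x \<Rightarrow> complex) \<Rightarrow> real" where
  "L2_norm M f = sqrt (\<integral>x. (cmod (f x))\<^sup>2 \<partial>M)"

text \<open>
  The intersection with \<^term>\<open>L2_space M\<close> guards against the value 0 of the Bochner integral on
  non-integrable functions.
\<close>

definition L2_closure :: "'x measure \<Rightarrow> ('x \<Rightarrow> complex) set \<Rightarrow> ('x \<Rightarrow> complex) set" where
  "L2_closure M S =
    {g \<in> L2_space M. \<forall>e>0. \<exists>f \<in> S \<inter> L2_space M. L2_norm M (\<lambda>x. g x - f x) < e}"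

definition L2_orth_compl :: "'x measure \<Rightarrow> ('x \<Rightarrow> complex) set \<Rightarrow> ('x \<Rightarrow> complex) set" where
  "L2_orth_compl M S = {g \<in> L2_space M. \<forall>f\<in>S. L2_inner M g f = 0}"

definition L2_independent :: "'x measure \<Rightarrow> ('x \<Rightarrow> complex) set \<Rightarrow> bool" where
  "L2_independent M S \<longleftrightarrow>
    (\<forall>c :: ('x \<Rightarrow> complex) \<Rightarrow> complex.
      (AE x in M. (\<Sum>f\<in>S. c f * f x) = 0) \<longrightarrow> (\<forall>f\<in>S. c f = 0))"

text \<open>
  The dimension is \<open>\<infinity>\<close> for infinite-dimensional subspaces (unlike \<^const>\<open>vector_space.dim\<close>, which
  is 0 there).
\<close>

definition L2_dim :: "'x measure \<Rightarrow> ('x \<Rightarrow> complex) set \<Rightarrow> enat" where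
  "L2_dim M V = Sup {enat (card S) | S. finite S \<and> S \<subseteq> V \<and> L2_independent M S}"

definition L2_orthonormal_basis :: "'x measure \<Rightarrow> (nat \<Rightarrow> 'x \<Rightarrow> complex) \<Rightarrow> bool" where
  "L2_orthonormal_basis M \<psi> \<longleftrightarrow>
    (\<forall>n. \<psi> n \<in> L2_space M) \<and>
    (\<forall>m n. L2_inner M (\<psi> m) (\<psi> n) = (if m = n then 1 else 0)) \<and>
    L2_closure M {(\<lambda>x. \<Sum>k<N. c k * \<psi> k x) | N c. True} = L2_space M"

definition upper_semi_frame :: "'x measure \<Rightarrow> ('x \<Rightarrow> 'h::complex_hilbert_space) \<Rightarrow> bool" where
  "upper_semi_frame M \<Psi> \<longleftrightarrow>
    (\<forall>f. (\<lambda>x. cinner f (\<Psi> x)) \<in> borel_measurable M) \<and>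
    (\<exists>B>0. \<forall>f. f \<noteq> 0 \<longrightarrow>
      0 < (\<integral>\<^sup>+x. ennreal ((cmod (cinner f (\<Psi> x)))\<^sup>2) \<partial>M) \<and>
      (\<integral>\<^sup>+x. ennreal ((cmod (cinner f (\<Psi> x)))\<^sup>2) \<partial>M) \<le> ennreal (B * (norm f)\<^sup>2))"

definition analysis_op :: "('x \<Rightarrow> 'h::complex_hilbert_space) \<Rightarrow> 'h \<Rightarrow> 'x \<Rightarrow> complex" where
  "analysis_op \<Psi> f = (\<lambda>x. cinner f (\<Psi> x))"

definition redundancy :: "'x measure \<Rightarrow> ('x \<Rightarrow> 'h::complex_hilbert_space) \<Rightarrow> enat" where
  "redundancy M \<Psi> = L2_dim M (L2_orth_compl M (range (analysis_op \<Psi>)))"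

end

theory Submission
  imports Defs
begin

text \<open>
  A maximal orthonormal set \<open>{e\<^sub>n}\<close> of \<open>\<H>\<close> is countably infinite, and
  \<open>\<Psi>\<^sub>x = \<Sum>n. 2\<^sup>-\<^sup>n cnj (\<psi>\<^sub>n x) e\<^sub>n\<close> converges absolutely because the \<open>\<psi>\<^sub>n\<close> are uniformly bounded.
  Then \<open>C\<^sub>\<Psi> f = \<Sum>n. 2\<^sup>-\<^sup>n \<langle>f, e\<^sub>n\<rangle> \<psi>\<^sub>n\<close>, both pointwise and in \<open>L\<^sup>2\<close>: this operator is bounded and injective,
  and its range contains every finite linear combination of the \<open>\<psi>\<^sub>n\<close>.
\<close>

section \<open>Complex inner product spaces\<close>

lemma cinner_zero_left [simp]: "cinner 0 y = 0"
  using cinner_add_left[of 0 0 y] by simp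

lemma cinner_minus_left [simp]: "cinner (- x) y = - cinner x y"
  using cinner_add_left[of x "- x" y] by (simp add: add_eq_0_iff)

lemma cinner_diff_left: "cinner (x - y) z = cinner x z - cinner y z"
  using cinner_add_left[of x "- y" z] by simp

lemma cinner_sum_left: "cinner (\<Sum>i\<in>A. f i) y = (\<Sum>i\<in>A. cinner (f i) y)"
  by (induction A rule: infinite_finite_induct) (auto simp: cinner_add_left)

lemma cinner_add_right: "cinner x (y + z) = cinner x y + cinner x z"
  by (metis cinner_add_left cinner_commute complex_cnj_add)

lemma cinner_scaleC_right: "cinner x (a *\<^sub>C y) = cnj a * cinner x y"
  by (metis cinner_scaleC_left cinner_commute complex_cnj_mult)

lemma cinner_diff_right: "cinner x (y - z) = cinner x y - cinner x z"
  by (metis cinner_diff_left cinner_commute complex_cnj_diff)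

lemma cinner_self: "cinner x x = complex_of_real ((norm x)\<^sup>2)"
proof -
  have "Im (cinner x x) = 0"
    using arg_cong[OF cinner_commute[of x x], of Im] by simp
  then show ?thesis
    by (simp add: complex_eq_iff norm_eq_sqrt_cinner cinner_ge_zero)
qed

text \<open>The identity is obtained for squares inside the complex numbers, where
  \<open>cinner_self\<close> turns norms into inner products, and is then pulled back to the
  reals.\<close>

lemma norm_scaleC: "norm (a *\<^sub>C x) = cmod a * norm (x :: 'a::complex_inner)"
proof -
  have "complex_of_real ((norm (a *\<^sub>C x))\<^sup>2) = a * cnj a * complex_of_real ((norm x)\<^sup>2)"
    unfolding cinner_self[symmetric] by (simp add: cinner_scaleC_left cinner_scaleC_right)
  also have "\<dots> = complex_of_real ((cmod a * norm x)\<^sup>2)"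
    by (simp only: complex_norm_square[symmetric] of_real_mult power_mult_distrib of_real_power)
  finally have "(norm (a *\<^sub>C x))\<^sup>2 = (cmod a * norm x)\<^sup>2"
    by (simp only: of_real_eq_iff)
  then show ?thesis
    by (simp add: power2_eq_iff_nonneg)
qed

text \<open>Cauchy-Schwarz. Subtracting from \<open>x\<close> its projection
  \<open>t *\<^sub>C y\<close> leaves a vector \<open>z\<close> orthogonal to \<open>y\<close>;
  computing the squared norm of \<open>z\<close>, which is nonnegative, gives the bound.\<close>

lemma norm_cinner_le: "cmod (cinner x y) \<le> norm x * norm (y :: 'a::complex_inner)"
proof (cases "y = 0")
  case True
  then show ?thesis
    by (metis cinner_commute cinner_zero_left complex_cnj_zero mult_zero_right norm_zero order_refl)
next
  case False
  define t where "t = cinner x y / complex_of_real ((norm y)\<^sup>2)"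
  define z where "z = x - t *\<^sub>C y"
  have ny: "norm y > 0" using False by simp
  have ts: "t * complex_of_real ((norm y)\<^sup>2) = cinner x y"
    using ny by (simp add: t_def)
  have zy: "cinner z y = 0"
    by (simp add: z_def cinner_diff_left cinner_scaleC_left cinner_self ts del: of_real_power)
  have "cinner z z = cinner z x"
    using zy by (subst (2) z_def) (simp add: cinner_diff_right cinner_scaleC_right)
  also have "\<dots> = cinner x x - t * cnj (cinner x y)"
    by (simp add: z_def cinner_diff_left cinner_scaleC_left cinner_commute[of y x])
  also have "t * cnj (cinner x y) = complex_of_real ((cmod (cinner x y))\<^sup>2 / (norm y)\<^sup>2)"
    by (simp add: t_def complex_norm_square del: of_real_power)
  finally have "complex_of_real ((norm z)\<^sup>2) =
      complex_of_real ((norm x)\<^sup>2 - (cmod (cinner x y))\<^sup>2 / (norm y)\<^sup>2)"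
    by (simp add: cinner_self)
  then have "(norm x)\<^sup>2 - (cmod (cinner x y))\<^sup>2 / (norm y)\<^sup>2 \<ge> 0"
    by (metis of_real_eq_iff zero_le_power2)
  then have "(cmod (cinner x y))\<^sup>2 \<le> (norm x * norm y)\<^sup>2"
    using ny by (simp add: field_simps power_mult_distrib)
  then show ?thesis
    by (rule power2_le_imp_le) simp
qed

text \<open>Conjugate-linearity over the complex numbers is linearity over the reals, and
  Cauchy-Schwarz bounds the map. This lets an inner product pass inside a convergent series of
  vectors.\<close>

lemma bounded_linear_cinner_right: "bounded_linear (cinner (x :: 'a::complex_inner))"
proof (rule bounded_linear_intro[where K = "norm x"])
  show "cmod (cinner x y) \<le> norm y * norm x" for y
    using norm_cinner_le[of x y] by (simp add: mult.commute)
qed (simp_all add: cinner_add_right scaleR_scaleC cinner_scaleC_right scaleR_conv_of_real)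

section \<open>Orthonormal bases of separable spaces\<close>

definition orthonormal_set :: "'a::complex_inner set \<Rightarrow> bool" where
  "orthonormal_set E \<longleftrightarrow> (\<forall>x\<in>E. \<forall>y\<in>E. cinner x y = (if x = y then 1 else 0))"

text \<open>Distinct orthonormal vectors are at distance sqrt 2, so one point of the dense set
  cannot lie within 1/2 of both. Choosing such nearby points therefore maps \<open>E\<close>
  injectively into a countable set.\<close>

lemma orthonormal_set_countable:
  assumes "separable_hilbert TYPE('h::complex_hilbert_space)" "orthonormal_set (E :: 'h set)"
  shows "countable E"
proof -
  obtain D :: "'h set" where D: "countable D" "closure D = UNIV"
    using assms(1) unfolding separable_hilbert_def by blast
  have "\<exists>d\<in>D. dist d e < 1/2" for e
    using D(2) closure_approachable[of e D] by (auto dest!: spec[of _ "1/2"])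
  then obtain d where d: "\<And>e. d e \<in> D" "\<And>e. dist (d e) e < 1/2"
    by metis
  have "inj_on d E"
  proof (rule inj_onI)
    fix x y assume xy: "x \<in> E" "y \<in> E" "d x = d y"
    show "x = y"
    proof (rule ccontr)
      assume "x \<noteq> y"
      then have "cinner (x - y) (x - y) = 2"
        using assms(2) xy unfolding orthonormal_set_def
        by (simp add: cinner_diff_left cinner_diff_right)
      then have "(norm (x - y))\<^sup>2 = 2"
        unfolding cinner_self by (metis of_real_eq_iff of_real_numeral)
      moreover have "norm (x - y) < 1"
        using d(2)[of x] d(2)[of y] xy(3) dist_triangle_half_r[of "d x" x 1 y]
        by (simp add: dist_norm)
      then have "(norm (x - y))\<^sup>2 \<le> 1"
        by (simp add: power_le_one)
      ultimately show False by simp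
    qed
  qed
  then show ?thesis
    using D(1) d(1) by (meson countable_image_inj_on countable_subset image_subsetI)
qed

text \<open>Zorn's lemma gives a maximal orthonormal set. A nonzero vector orthogonal to all of it
  could be normalised and added, against maximality.\<close>

lemma exists_maximal_orthonormal_set:
  obtains E :: "'a::complex_inner set"
  where "orthonormal_set E" "\<And>f. (\<And>e. e \<in> E \<Longrightarrow> cinner f e = 0) \<Longrightarrow> f = 0"
proof -
  have "\<exists>E\<in>Collect orthonormal_set. \<forall>X\<in>Collect orthonormal_set. E \<subseteq> X \<longrightarrow> X = (E :: 'a set)"
  proof (rule subset_Zorn')
    fix C :: "'a set set" assume C: "subset.chain (Collect orthonormal_set) C"
    have "orthonormal_set (\<Union>C)"
      unfolding orthonormal_set_def
    proof (intro ballI)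
      fix x y assume "x \<in> \<Union>C" "y \<in> \<Union>C"
      then obtain X Y where XY: "x \<in> X" "X \<in> C" "y \<in> Y" "Y \<in> C" by blast
      then have "X \<subseteq> Y \<or> Y \<subseteq> X"
        using C by (auto simp: subset_chain_def)
      then obtain Z where "Z \<in> C" "x \<in> Z" "y \<in> Z" using XY by blast
      then show "cinner x y = (if x = y then 1 else 0)"
        using C unfolding subset_chain_def orthonormal_set_def by blast
    qed
    then show "\<Union>C \<in> Collect orthonormal_set" by simp
  qed
  then obtain E :: "'a set" where E: "orthonormal_set E"
    and max: "\<And>X. orthonormal_set X \<Longrightarrow> E \<subseteq> X \<Longrightarrow> X = E" by blast
  have "f = 0" if f: "\<And>e. e \<in> E \<Longrightarrow> cinner f e = 0" for f
  proof (rule ccontr)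
    assume "f \<noteq> 0"
    define u where "u = complex_of_real (1 / norm f) *\<^sub>C f"
    have nu: "norm u = 1" using \<open>f \<noteq> 0\<close> by (simp add: u_def norm_scaleC norm_divide)
    have u1: "cinner u u = 1" by (simp add: cinner_self nu)
    have u2: "cinner u e = 0" "cinner e u = 0" if "e \<in> E" for e
    proof -
      show "cinner u e = 0" using f[OF that] by (simp add: u_def cinner_scaleC_left)
      then show "cinner e u = 0" using cinner_commute[of e u] by simp
    qed
    have "orthonormal_set (insert u E)"
      using E u1 u2 unfolding orthonormal_set_def by auto
    then have "u \<in> E" using max by blast
    then show False using u1 u2 by force
  qed
  then show ?thesis using E that by blast
qed

text \<open>The residual of \<open>f\<close> after its finite orthogonal expansion is orthogonal to
  \<open>E\<close>, hence zero. This rules out a finite basis when the space is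
  infinite-dimensional.\<close>

lemma finite_maximal_orthonormal_set_spans:
  assumes "finite E" "orthonormal_set E" "\<And>f. (\<And>e. e \<in> E \<Longrightarrow> cinner f e = 0) \<Longrightarrow> f = 0"
  shows "complex_vector.span E = UNIV"
proof -
  have "f \<in> complex_vector.span E" for f
  proof -
    define p where "p = (\<Sum>e\<in>E. cinner f e *\<^sub>C e)"
    have "cinner (f - p) e = 0" if "e \<in> E" for e
    proof -
      have "cinner p e = (\<Sum>d\<in>E. cinner f d * (if d = e then 1 else 0))"
        unfolding p_def cinner_sum_left cinner_scaleC_left
        by (rule sum.cong) (use assms(2) that in \<open>auto simp: orthonormal_set_def\<close>)
      then show ?thesis using assms(1) that by (simp add: cinner_diff_left if_distrib cong: if_cong)
    qed
    then have "f = p" using assms(3)[of "f - p"] by simp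
    moreover have "p \<in> complex_vector.span E"
      unfolding p_def
      by (simp add: complex_vector.span_base complex_vector.span_scale complex_vector.span_sum)
    ultimately show ?thesis by simp
  qed
  then show ?thesis by blast
qed

lemma separable_hilbert_orthonormal_basis:
  assumes "separable_hilbert TYPE('h::complex_hilbert_space)" "infinite_dimensional TYPE('h)"
  obtains e :: "nat \<Rightarrow> 'h::complex_hilbert_space"
  where "\<And>m n. cinner (e m) (e n) = (if m = n then 1 else 0)"
    and "\<And>f. (\<And>n. cinner f (e n) = 0) \<Longrightarrow> f = 0"
proof -
  obtain E :: "'h set" where E: "orthonormal_set E"
    and total: "\<And>f. (\<And>e. e \<in> E \<Longrightarrow> cinner f e = 0) \<Longrightarrow> f = 0"
    using exists_maximal_orthonormal_set by blast
  have "infinite E"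
    using finite_maximal_orthonormal_set_spans[OF _ E total] assms(2)
    unfolding infinite_dimensional_def by blast
  \<comment> \<open>Countable and infinite together make the standard enumeration a bijection, so
    that distinct indices give distinct basis vectors.\<close>
  then have b: "bij_betw (from_nat_into E) UNIV E"
    using orthonormal_set_countable[OF assms(1) E] by (simp add: bij_betw_from_nat_into)
  show ?thesis
  proof
    show "cinner (from_nat_into E m) (from_nat_into E n) = (if m = n then 1 else 0)" for m n
    proof -
      have "from_nat_into E m \<in> E" "from_nat_into E n \<in> E"
        using b by (auto simp: bij_betw_def)
      then show ?thesis
        using E inj_eq[OF bij_betw_imp_inj_on[OF b], of m n] by (simp add: orthonormal_set_def)
    qed
    show "f = 0" if "\<And>n. cinner f (from_nat_into E n) = 0" for f
    proof (rule total)
      fix e assume "e \<in> E"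
      then obtain n where "e = from_nat_into E n"
        using b by (auto simp: bij_betw_def)
      then show "cinner f e = 0" using that by simp
    qed
  qed
qed

section \<open>Orthonormal expansions of square-integrable functions\<close>

lemma L2_space_scale: "f \<in> L2_space M \<Longrightarrow> (\<lambda>x. a * f x) \<in> L2_space M"
  by (auto simp: L2_space_def norm_mult power_mult_distrib)

lemma L2_space_add:
  assumes "f \<in> L2_space M" "g \<in> L2_space M"
  shows "(\<lambda>x. f x + g x) \<in> L2_space M"
proof -
  have [measurable]: "f \<in> borel_measurable M" "g \<in> borel_measurable M"
    using assms by (auto simp: L2_space_def)
  have "(cmod (a + b))\<^sup>2 \<le> 2 * (cmod a)\<^sup>2 + 2 * (cmod b)\<^sup>2" for a b
  proof -
    have "(cmod (a + b))\<^sup>2 \<le> (cmod a + cmod b)\<^sup>2"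
      by (simp add: norm_triangle_ineq power_mono)
    also have "\<dots> \<le> 2 * (cmod a)\<^sup>2 + 2 * (cmod b)\<^sup>2"
      using sum_squares_bound[of "cmod a" "cmod b"] by (simp add: power2_sum)
    finally show ?thesis .
  qed
  moreover have "integrable M (\<lambda>x. 2 * (cmod (f x))\<^sup>2 + 2 * (cmod (g x))\<^sup>2)"
    using assms by (auto simp: L2_space_def)
  ultimately have "integrable M (\<lambda>x. (cmod (f x + g x))\<^sup>2)"
    by (elim Bochner_Integration.integrable_bound) auto
  then show ?thesis by (simp add: L2_space_def)
qed

lemma L2_space_sum:
  assumes "\<And>i. i \<in> A \<Longrightarrow> f i \<in> L2_space M"
  shows "(\<lambda>x. \<Sum>i\<in>A. f i x) \<in> L2_space M"
proof -
  \<comment> \<open>The zero function covers both the empty sum and an infinite \<open>A\<close>,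
    where the sum defaults to 0.\<close>
  have z: "(\<lambda>x. 0) \<in> L2_space M" by (simp add: L2_space_def)
  show ?thesis
    using assms by (induction A rule: infinite_finite_induct) (auto simp: z L2_space_add)
qed

lemma L2_space_integrable_mult:
  assumes "f \<in> L2_space M" "g \<in> L2_space M"
  shows "integrable M (\<lambda>x. f x * cnj (g x))"
proof -
  have [measurable]: "f \<in> borel_measurable M" "g \<in> borel_measurable M"
    using assms by (auto simp: L2_space_def)
  have [measurable]: "cnj \<in> borel_measurable borel"
    by (intro borel_measurable_continuous_onI continuous_intros)
  have "(\<lambda>x. f x * cnj (g x)) \<in> borel_measurable M"
    by measurable
  moreover have "cmod a * cmod b \<le> (cmod a)\<^sup>2 + (cmod b)\<^sup>2" for a b
  proof -
    have "2 * (cmod a * cmod b) \<le> (cmod a)\<^sup>2 + (cmod b)\<^sup>2"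
      using sum_squares_bound[of "cmod a" "cmod b"] by (simp add: mult.assoc)
    moreover have "0 \<le> cmod a * cmod b" by simp
    ultimately show ?thesis by linarith
  qed
  moreover have "integrable M (\<lambda>x. (cmod (f x))\<^sup>2 + (cmod (g x))\<^sup>2)"
    using assms by (auto simp: L2_space_def)
  ultimately show ?thesis
    by (elim Bochner_Integration.integrable_bound) (auto simp: norm_mult)
qed

lemma L2_inner_self: "L2_inner M f f = complex_of_real (\<integral>x. (cmod (f x))\<^sup>2 \<partial>M)"
  by (simp add: L2_inner_def complex_norm_square[symmetric] del: of_real_power)

lemma L2_inner_commute: "L2_inner M f g = cnj (L2_inner M g f)"
  using Bochner_Integration.integral_cnj[of M "\<lambda>x. g x * cnj (f x)"] by (simp add: L2_inner_def mult.commute)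

text \<open>Pythagoras: the two mixed terms of the expanded square are conjugate to each other, so
  both vanish.\<close>

lemma integral_norm_square_diff_orthogonal:
  assumes f: "f \<in> L2_space M" and g: "g \<in> L2_space M" and "L2_inner M f g = 0"
  shows "(\<integral>x. (cmod (f x - g x))\<^sup>2 \<partial>M) = (\<integral>x. (cmod (f x))\<^sup>2 \<partial>M) + (\<integral>x. (cmod (g x))\<^sup>2 \<partial>M)"
proof -
  have "complex_of_real (\<integral>x. (cmod (f x - g x))\<^sup>2 \<partial>M) =
      (\<integral>x. (f x * cnj (f x) - f x * cnj (g x)) - (g x * cnj (f x) - g x * cnj (g x)) \<partial>M)"
    unfolding L2_inner_self[symmetric] L2_inner_def by (simp add: algebra_simps)
  also have "\<dots> = (L2_inner M f f - L2_inner M f g) - (L2_inner M g f - L2_inner M g g)"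
    by (simp add: L2_inner_def L2_space_integrable_mult f g)
  also have "\<dots> = complex_of_real ((\<integral>x. (cmod (f x))\<^sup>2 \<partial>M) + (\<integral>x. (cmod (g x))\<^sup>2 \<partial>M))"
    using assms(3) L2_inner_commute[of M g f] by (simp add: L2_inner_self)
  finally show ?thesis by (simp only: of_real_eq_iff)
qed

text \<open>Finite Parseval identity: the square expands to a double sum of inner products, of which
  only the diagonal survives.\<close>

lemma integral_norm_square_orthonormal_sum:
  assumes "\<And>n. \<psi> n \<in> L2_space M"
    and "\<And>m n. L2_inner M (\<psi> m) (\<psi> n) = (if m = n then 1 else 0)" and "finite A"
  shows "(\<integral>x. (cmod (\<Sum>k\<in>A. c k * \<psi> k x))\<^sup>2 \<partial>M) = (\<Sum>k\<in>A. (cmod (c k))\<^sup>2)"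
proof -
  have "complex_of_real (\<integral>x. (cmod (\<Sum>k\<in>A. c k * \<psi> k x))\<^sup>2 \<partial>M) =
      (\<integral>x. (\<Sum>j\<in>A. \<Sum>k\<in>A. (c j * cnj (c k)) * (\<psi> j x * cnj (\<psi> k x))) \<partial>M)"
    unfolding L2_inner_self[symmetric] L2_inner_def
    by (simp add: sum_product algebra_simps)
  also have "\<dots> = (\<Sum>j\<in>A. \<Sum>k\<in>A. (c j * cnj (c k)) * L2_inner M (\<psi> j) (\<psi> k))"
    by (simp add: L2_inner_def L2_space_integrable_mult assms(1))
  also have "\<dots> = (\<Sum>j\<in>A. c j * cnj (c j))"
    by (simp add: assms if_distrib cong: if_cong)
  also have "\<dots> = complex_of_real (\<Sum>k\<in>A. (cmod (c k))\<^sup>2)"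
    by (simp add: complex_norm_square del: of_real_power)
  finally show ?thesis by (simp only: of_real_eq_iff)
qed

text \<open>Fatou's lemma for the partial sums turns pointwise convergence into \<open>L\<^sup>2\<close> convergence.\<close>

lemma nn_integral_orthonormal_series_tail:
  assumes \<psi>: "\<And>n. \<psi> n \<in> L2_space M"
    and on: "\<And>m n. L2_inner M (\<psi> m) (\<psi> n) = (if m = n then 1 else 0)"
    and c: "summable (\<lambda>n. (cmod (c n))\<^sup>2)"
    and g: "\<And>x. x \<in> space M \<Longrightarrow> (\<lambda>n. c n * \<psi> n x) sums g x"
  shows "(\<integral>\<^sup>+x. ennreal ((cmod (g x - (\<Sum>k<N. c k * \<psi> k x)))\<^sup>2) \<partial>M)
      \<le> ennreal (\<Sum>n. (cmod (c (n + N)))\<^sup>2)"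
proof -
  define S where "S A x = (\<Sum>k\<in>A. c k * \<psi> k x)" for A x
  have SL2: "S A \<in> L2_space M" for A
    unfolding S_def by (intro L2_space_sum L2_space_scale \<psi>)
  then have [measurable]: "S A \<in> borel_measurable M" for A
    by (simp add: L2_space_def)
  have lim: "ennreal ((cmod (g x - S {..<N} x))\<^sup>2) =
      liminf (\<lambda>m. ennreal ((cmod (S {N..<m} x))\<^sup>2))" if "x \<in> space M" for x
  proof -
    have "(\<lambda>m. S {..<m} x) \<longlonglongrightarrow> g x"
      using g[OF that] by (simp add: sums_def S_def)
    then have "(\<lambda>m. S {..<m} x - S {..<N} x) \<longlonglongrightarrow> g x - S {..<N} x"
      by (intro tendsto_intros)
    \<comment> \<open>The difference of partial sums is the block from \<open>N\<close> to
      \<open>m\<close> only once \<open>m\<close> \<ge> \<open>N\<close>, which is enough for the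
      limit.\<close>
    moreover have "\<forall>\<^sub>F m in sequentially. S {..<m} x - S {..<N} x = S {N..<m} x"
      using eventually_ge_at_top[of N]
      by eventually_elim
        (simp add: S_def lessThan_atLeast0 sum_diff_nat_ivl)
    ultimately have "(\<lambda>m. S {N..<m} x) \<longlonglongrightarrow> g x - S {..<N} x"
      by (simp add: tendsto_cong)
    then have "(\<lambda>m. ennreal ((cmod (S {N..<m} x))\<^sup>2)) \<longlonglongrightarrow> ennreal ((cmod (g x - S {..<N} x))\<^sup>2)"
      by (intro tendsto_intros)
    then show ?thesis
      by (rule lim_imp_Liminf[OF trivial_limit_sequentially, symmetric])
  qed
  have "(\<integral>\<^sup>+x. ennreal ((cmod (g x - S {..<N} x))\<^sup>2) \<partial>M) =
      (\<integral>\<^sup>+x. liminf (\<lambda>m. ennreal ((cmod (S {N..<m} x))\<^sup>2)) \<partial>M)"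
    by (intro nn_integral_cong lim)
  also have "\<dots> \<le> liminf (\<lambda>m. \<integral>\<^sup>+x. ennreal ((cmod (S {N..<m} x))\<^sup>2) \<partial>M)"
    by (rule nn_integral_liminf) measurable
  also have "\<dots> = liminf (\<lambda>m. ennreal (\<Sum>k\<in>{N..<m}. (cmod (c k))\<^sup>2))"
  proof -
    have "(\<integral>\<^sup>+x. ennreal ((cmod (S {N..<m} x))\<^sup>2) \<partial>M) = ennreal (\<Sum>k\<in>{N..<m}. (cmod (c k))\<^sup>2)" for m
      using integral_norm_square_orthonormal_sum[OF \<psi> on, of "{N..<m}" c] SL2[of "{N..<m}"]
      by (subst nn_integral_eq_integral) (auto simp: L2_space_def S_def)
    then show ?thesis by simp
  qed
  also have "\<dots> \<le> ennreal (\<Sum>n. (cmod (c (n + N)))\<^sup>2)"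
  proof -
    have "(\<Sum>k\<in>{N..<m}. (cmod (c k))\<^sup>2) \<le> (\<Sum>n. (cmod (c (n + N)))\<^sup>2)" for m
    proof -
      \<comment> \<open>For \<open>m < N\<close> the truncated subtraction gives 0, and both sums
        are empty.\<close>
      have "(\<Sum>k\<in>{N..<m}. (cmod (c k))\<^sup>2) = (\<Sum>n<m - N. (cmod (c (n + N)))\<^sup>2)"
        by (rule sum.reindex_bij_witness[of _ "\<lambda>n. n + N" "\<lambda>k. k - N"]) auto
      also have "\<dots> \<le> (\<Sum>n. (cmod (c (n + N)))\<^sup>2)"
        using c by (intro sum_le_suminf) (auto simp: summable_iff_shift[of "\<lambda>n. (cmod (c n))\<^sup>2"])
      finally show ?thesis .
    qed
    then show ?thesis
      by (intro Liminf_le always_eventually allI ennreal_leI) auto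
  qed
  finally show ?thesis by (simp add: S_def)
qed

text \<open>When \<open>g\<close> is null, the squared norm of the \<open>N\<close>-th partial sum
  is also its squared distance from \<open>g\<close>, hence at most the tail of the coefficients. As
  \<open>N\<close> grows, the former tends to the full sum of squares and the latter to 0. This
  yields injectivity of the analysis operator.\<close>

lemma orthonormal_series_null_imp_coeff_zero:
  assumes \<psi>: "\<And>n. \<psi> n \<in> L2_space M"
    and on: "\<And>m n. L2_inner M (\<psi> m) (\<psi> n) = (if m = n then 1 else 0)"
    and c: "summable (\<lambda>n. (cmod (c n))\<^sup>2)"
    and g: "\<And>x. x \<in> space M \<Longrightarrow> (\<lambda>n. c n * \<psi> n x) sums g x"
    and null: "AE x in M. g x = 0"
  shows "c n = 0"
proof -
  have "(\<Sum>k<N. (cmod (c k))\<^sup>2) \<le> (\<Sum>n. (cmod (c (n + N)))\<^sup>2)" for N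
  proof -
    have L2: "(\<lambda>x. \<Sum>k<N. c k * \<psi> k x) \<in> L2_space M"
      by (intro L2_space_sum L2_space_scale \<psi>)
    have "ennreal (\<Sum>k<N. (cmod (c k))\<^sup>2) = (\<integral>\<^sup>+x. ennreal ((cmod (\<Sum>k<N. c k * \<psi> k x))\<^sup>2) \<partial>M)"
      using L2 integral_norm_square_orthonormal_sum[OF \<psi> on, of "{..<N}" c]
      by (subst nn_integral_eq_integral) (auto simp: L2_space_def)
    also have "\<dots> = (\<integral>\<^sup>+x. ennreal ((cmod (g x - (\<Sum>k<N. c k * \<psi> k x)))\<^sup>2) \<partial>M)"
      using null by (intro nn_integral_cong_AE) auto
    also have "\<dots> \<le> ennreal (\<Sum>n. (cmod (c (n + N)))\<^sup>2)"
      by (rule nn_integral_orthonormal_series_tail[OF \<psi> on c g])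
    finally show ?thesis
      using c by (subst (asm) ennreal_le_iff)
        (auto intro!: suminf_nonneg simp: summable_iff_shift[of "\<lambda>n. (cmod (c n))\<^sup>2"])
  qed
  moreover have "(\<lambda>N. \<Sum>k<N. (cmod (c k))\<^sup>2) \<longlonglongrightarrow> (\<Sum>k. (cmod (c k))\<^sup>2)"
    using c by (rule summable_LIMSEQ)
  moreover have "(\<lambda>N. \<Sum>n. (cmod (c (n + N)))\<^sup>2) \<longlonglongrightarrow> 0"
    using c by (rule suminf_exist_split2)
  ultimately have "(\<Sum>k. (cmod (c k))\<^sup>2) \<le> 0"
    by (meson LIMSEQ_le)
  then have "(\<Sum>k. (cmod (c k))\<^sup>2) = 0"
    using c by (intro antisym suminf_nonneg) auto
  then show ?thesis
    using suminf_eq_zero_iff[OF c] by simp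
qed

section \<open>Density and redundancy\<close>

text \<open>For \<open>f\<close> in \<open>S\<close>, Pythagoras shows that \<open>g\<close> is no
  larger in norm than \<open>g - f\<close>, and density makes the latter arbitrarily small.\<close>

lemma orth_compl_dense_null:
  assumes "g \<in> L2_orth_compl M S" and dense: "L2_closure M S = L2_space M"
  shows "AE x in M. g x = 0"
proof -
  have g: "g \<in> L2_space M" and orth: "\<And>f. f \<in> S \<Longrightarrow> L2_inner M g f = 0"
    using assms(1) by (auto simp: L2_orth_compl_def)
  have "L2_norm M g \<le> 0 + e" if "e > 0" for e
  proof -
    obtain f where f: "f \<in> S" "f \<in> L2_space M" "L2_norm M (\<lambda>x. g x - f x) < e"
      using g dense \<open>e > 0\<close> unfolding L2_closure_def by blast
    have "L2_norm M g \<le> L2_norm M (\<lambda>x. g x - f x)"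
      unfolding L2_norm_def integral_norm_square_diff_orthogonal[OF g f(2) orth[OF f(1)]]
      by simp
    then show ?thesis using f(3) by simp
  qed
  then have "L2_norm M g \<le> 0" by (rule field_le_epsilon)
  then have "(\<integral>x. (cmod (g x))\<^sup>2 \<partial>M) = 0"
    unfolding L2_norm_def by (simp add: antisym)
  then have "AE x in M. (cmod (g x))\<^sup>2 = 0"
    using g by (subst (asm) integral_nonneg_eq_0_iff_AE) (auto simp: L2_space_def)
  then show ?thesis by simp
qed

text \<open>A null function \<open>g\<close> in a finite set gives a null combination with
  coefficient 1 at \<open>g\<close> and 0 elsewhere, so only the empty set is independent.\<close>

lemma L2_dim_null:
  assumes "\<And>g. g \<in> V \<Longrightarrow> AE x in M. g x = 0"
  shows "L2_dim M V = 0"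
proof -
  have "S = {}" if S: "finite S" "S \<subseteq> V" "L2_independent M S" for S
  proof (rule ccontr)
    assume "S \<noteq> {}"
    then obtain g where g: "g \<in> S" by blast
    have "(\<Sum>f\<in>S. (if f = g then 1 else 0) * f x) = g x" for x
      using S(1) g by (simp add: if_distrib[of "\<lambda>a. a * _"] cong: if_cong)
    then have "AE x in M. (\<Sum>f\<in>S. (if f = g then 1 else 0) * f x) = 0"
      using assms g S(2) by auto
    with S(3) have "\<forall>f\<in>S. (if f = g then 1 else 0) = (0 :: complex)"
      unfolding L2_independent_def by (elim allE[of _ "\<lambda>f. if f = g then 1 else 0"]) (rule mp)
    then have "(1 :: complex) = 0" using g by force
    then show False by simp
  qed
  then have "L2_dim M V \<le> 0"
    unfolding L2_dim_def by (intro Sup_least) (auto simp: zero_enat_def)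
  then show ?thesis by simp
qed

section \<open>Construction of the semi-frame, its bounds, and density of its range\<close>

theorem proposition20:
  fixes M :: "'x measure" and \<psi> :: "nat \<Rightarrow> 'x \<Rightarrow> complex"
  assumes "separable_hilbert TYPE('h::complex_hilbert_space)"
    and "infinite_dimensional TYPE('h)"
    and "sigma_finite_measure M"
    and "emeasure M (space M) \<noteq> 0"
    and "L2_orthonormal_basis M \<psi>"
    and "(SUP n. SUP x\<in>space M. ennreal (cmod (\<psi> n x))) < \<infinity>"
  shows "\<exists>\<Psi> :: 'x \<Rightarrow> 'h.
    upper_semi_frame M \<Psi> \<and>
    L2_closure M (range (analysis_op \<Psi>)) = L2_space M \<and>
    redundancy M \<Psi> = 0"
proof -
  obtain e :: "nat \<Rightarrow> 'h"
    where e: "\<And>m n. cinner (e m) (e n) = (if m = n then 1 else 0)"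
      and total: "\<And>f. (\<And>n. cinner f (e n) = 0) \<Longrightarrow> f = 0"
    using separable_hilbert_orthonormal_basis[OF assms(1,2)] by blast
  have ne: "norm (e n) = 1" for n
    by (simp add: norm_eq_sqrt_cinner e)
  have \<psi>: "\<And>n. \<psi> n \<in> L2_space M"
    and on: "\<And>m n. L2_inner M (\<psi> m) (\<psi> n) = (if m = n then 1 else 0)"
    and dense: "L2_closure M {(\<lambda>x. \<Sum>k<N. c k * \<psi> k x) | N c. True} = L2_space M"
    using assms(5) unfolding L2_orthonormal_basis_def by blast+
  \<comment> \<open>The supremum is extended-real; being finite, its real value serves as the
    uniform bound.\<close>
  obtain C where C: "\<And>n x. x \<in> space M \<Longrightarrow> cmod (\<psi> n x) \<le> C"
  proof
    fix n x assume "x \<in> space M"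
    then have "ennreal (cmod (\<psi> n x)) \<le> (SUP n. SUP x\<in>space M. ennreal (cmod (\<psi> n x)))"
      by (meson SUP_upper SUP_upper2 UNIV_I)
    then show "cmod (\<psi> n x) \<le> enn2real (SUP n. SUP x\<in>space M. ennreal (cmod (\<psi> n x)))"
      using assms(6) by (metis enn2real_ennreal enn2real_mono infinity_ennreal_def norm_ge_zero)
  qed
  \<comment> \<open>The conjugate on \<open>\<psi> n x\<close> cancels against conjugate-linearity
    in the second argument of \<open>cinner\<close>. The weights make the series absolutely
    convergent at each point of \<open>space M\<close>; elsewhere its value is left open.\<close>
  define \<Psi> :: "'x \<Rightarrow> 'h" where "\<Psi> x = (\<Sum>n. ((1/2)^n * cnj (\<psi> n x)) *\<^sub>C e n)" for x
  \<comment> \<open>The coefficients of the analysis operator applied to \<open>f\<close>, relative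
    to the basis \<open>\<psi>\<close>.\<close>
  define b where "b f n = (1/2)^n * cinner f (e n)" for f n
  have sums: "(\<lambda>n. b f n * \<psi> n x) sums cinner f (\<Psi> x)" if x: "x \<in> space M" for f x
  proof -
    have "summable (\<lambda>n. ((1/2)^n * cnj (\<psi> n x)) *\<^sub>C e n)"
    proof (rule summable_comparison_test')
      show "summable (\<lambda>n. (1/2)^n * C)"
        by (intro summable_mult2 summable_geometric) simp
      show "norm (((1/2)^n * cnj (\<psi> n x)) *\<^sub>C e n) \<le> (1/2)^n * C" for n
        using C[OF x, of n] by (simp add: norm_scaleC ne norm_mult norm_power norm_divide divide_right_mono)
    qed
    then have "(\<lambda>n. cinner f (((1/2)^n * cnj (\<psi> n x)) *\<^sub>C e n)) sums cinner f (\<Psi> x)"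
      unfolding \<Psi>_def by (intro bounded_linear.sums[OF bounded_linear_cinner_right] summable_sums)
    then show ?thesis
      by (simp add: cinner_scaleC_right b_def mult_ac)
  qed
  have b_le: "(cmod (b f n))\<^sup>2 \<le> (1/4)^n * (norm f)\<^sup>2" for f n
  proof -
    have "cmod (b f n) \<le> (1/2)^n * norm f"
      using norm_cinner_le[of f "e n"]
      by (simp add: b_def norm_mult norm_power norm_divide ne divide_right_mono)
    then have "(cmod (b f n))\<^sup>2 \<le> ((1/2)^n * norm f)\<^sup>2"
      by (simp add: power_mono)
    also have "\<dots> = (1/4)^n * (norm f)\<^sup>2"
      by (simp add: power_mult_distrib power2_eq_square flip: power_mult_distrib)
    finally show ?thesis .
  qed
  have geo: "summable (\<lambda>n. (1/4 :: real)^n * (norm (f :: 'h))\<^sup>2)" for f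
    by (intro summable_mult2 summable_geometric) simp
  have b_summable: "summable (\<lambda>n. (cmod (b f n))\<^sup>2)" for f
    by (rule summable_comparison_test'[OF geo[of f], of 0]) (simp add: b_le)
  have meas: "(\<lambda>x. cinner f (\<Psi> x)) \<in> borel_measurable M" for f
  proof (rule borel_measurable_LIMSEQ_metric)
    show "(\<lambda>x. \<Sum>n<N. b f n * \<psi> n x) \<in> borel_measurable M" for N
      using \<psi> by (intro borel_measurable_sum borel_measurable_times) (auto simp: L2_space_def)
    show "(\<lambda>N. \<Sum>n<N. b f n * \<psi> n x) \<longlonglongrightarrow> cinner f (\<Psi> x)" if "x \<in> space M" for x
      using sums[OF that] by (simp add: sums_def)
  qed
  \<comment> \<open>The tail estimate with \<open>N = 0\<close> bounds the integral by the sum of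
    the squared coefficients. Each is at most \<open>(1/4)^n * (norm f)\<^sup>2\<close>, and the
    geometric series sums to 4/3.\<close>
  have upper: "(\<integral>\<^sup>+x. ennreal ((cmod (cinner f (\<Psi> x)))\<^sup>2) \<partial>M) \<le> ennreal (4/3 * (norm f)\<^sup>2)" for f
  proof -
    have "(\<integral>\<^sup>+x. ennreal ((cmod (cinner f (\<Psi> x)))\<^sup>2) \<partial>M) \<le> ennreal (\<Sum>n. (cmod (b f n))\<^sup>2)"
      using nn_integral_orthonormal_series_tail[OF \<psi> on b_summable sums, of f 0] by simp
    also have "(\<Sum>n. (cmod (b f n))\<^sup>2) \<le> (\<Sum>n. (1/4)^n * (norm f)\<^sup>2)"
      by (intro suminf_le b_le b_summable geo)
    also have "\<dots> = 4/3 * (norm f)\<^sup>2"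
      by (simp add: suminf_mult2[symmetric] suminf_geometric)
    finally show ?thesis by (simp add: ennreal_leI)
  qed
  \<comment> \<open>A vanishing integral makes the analysis function null, so every coefficient
    \<open>b f n\<close> is 0; the weights are nonzero, so \<open>f\<close> is orthogonal to every
    \<open>e n\<close>.\<close>
  have pos: "0 < (\<integral>\<^sup>+x. ennreal ((cmod (cinner f (\<Psi> x)))\<^sup>2) \<partial>M)" if "f \<noteq> 0" for f
  proof (rule ccontr)
    assume "\<not> ?thesis"
    then have null: "AE x in M. cinner f (\<Psi> x) = 0"
      using meas[of f] by (subst (asm) not_gr_zero, subst (asm) nn_integral_0_iff_AE) auto
    have "b f n = 0" for n
      by (rule orthonormal_series_null_imp_coeff_zero[OF \<psi> on b_summable sums null])
    then have "cinner f (e n) = 0" for n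
      by (simp add: b_def)
    then show False using total that by blast
  qed
  have frame: "upper_semi_frame M \<Psi>"
    unfolding upper_semi_frame_def
    by (intro conjI allI meas exI[of _ "4/3"] impI pos upper) simp
  \<comment> \<open>Needed for the intersection with \<open>L2_space M\<close> in
    \<open>L2_closure\<close>; the upper frame bound supplies integrability.\<close>
  have rangeL2: "analysis_op \<Psi> f \<in> L2_space M" for f
  proof -
    have "(\<integral>\<^sup>+x. ennreal ((cmod (cinner f (\<Psi> x)))\<^sup>2) \<partial>M) < \<infinity>"
      using upper[of f] by (simp add: le_less_trans)
    then show ?thesis
      using meas[of f] by (auto simp: L2_space_def analysis_op_def integrable_iff_bounded)
  qed
  have finite_sum: "\<exists>f. \<forall>x\<in>space M. analysis_op \<Psi> f x = (\<Sum>k<N. c k * \<psi> k x)" for N c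
  proof -
    \<comment> \<open>The factor \<open>2^k\<close> undoes the weight \<open>(1/2)^k\<close>, so the
      coefficients of \<open>f\<close> are the prescribed \<open>c k\<close> below \<open>N\<close>
      and 0 from \<open>N\<close> on.\<close>
    define f where "f = (\<Sum>k<N. (2^k * c k) *\<^sub>C e k)"
    have "b f n = (if n < N then c n else 0)" for n
      by (simp add: b_def f_def cinner_sum_left cinner_scaleC_left e if_distrib power_one_over
          cong: if_cong)
    then have "(\<lambda>n. b f n * \<psi> n x) sums (\<Sum>k<N. c k * \<psi> k x)" for x
      using sums_finite[of "{..<N}" "\<lambda>n. b f n * \<psi> n x"] by simp
    then show ?thesis
      using sums sums_unique2 unfolding analysis_op_def by blast
  qed
  have closure: "L2_closure M (range (analysis_op \<Psi>)) = L2_space M"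
  proof
    show "L2_closure M (range (analysis_op \<Psi>)) \<subseteq> L2_space M"
      by (auto simp: L2_closure_def)
    show "L2_space M \<subseteq> L2_closure M (range (analysis_op \<Psi>))"
    proof
      fix g assume g: "g \<in> L2_space M"
      have "\<exists>h\<in>range (analysis_op \<Psi>) \<inter> L2_space M. L2_norm M (\<lambda>x. g x - h x) < d" if "d > 0" for d
      proof -
        obtain N c where Nc: "L2_norm M (\<lambda>x. g x - (\<Sum>k<N. c k * \<psi> k x)) < d"
        proof -
          have "g \<in> L2_closure M {(\<lambda>x. \<Sum>k<N. c k * \<psi> k x) | N c. True}"
            using g dense by simp
          then obtain s where s: "s \<in> {(\<lambda>x. \<Sum>k<N. c k * \<psi> k x) | N c. True}"
            "L2_norm M (\<lambda>x. g x - s x) < d"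
            using \<open>d > 0\<close> unfolding L2_closure_def by blast
          then show thesis using that by blast
        qed
        obtain f where f: "\<And>x. x \<in> space M \<Longrightarrow> analysis_op \<Psi> f x = (\<Sum>k<N. c k * \<psi> k x)"
          using finite_sum by blast
        \<comment> \<open>The two functions are known to agree only on \<open>space M\<close>, which
          suffices for equality of the integrals.\<close>
        have "L2_norm M (\<lambda>x. g x - analysis_op \<Psi> f x) = L2_norm M (\<lambda>x. g x - (\<Sum>k<N. c k * \<psi> k x))"
          unfolding L2_norm_def
          by (intro arg_cong[of _ _ sqrt] Bochner_Integration.integral_cong) (simp_all add: f)
        then show ?thesis
          using Nc rangeL2 by (intro bexI[of _ "analysis_op \<Psi> f"]) auto
      qed
      then show "g \<in> L2_closure M (range (analysis_op \<Psi>))"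
        using g by (simp add: L2_closure_def)
    qed
  qed
  have "redundancy M \<Psi> = 0"
    unfolding redundancy_def by (rule L2_dim_null) (rule orth_compl_dense_null[OF _ closure])
  then show ?thesis using frame closure by blast
qed

end
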